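(* (a) A function $\Phi:[0,\infty)\to[0,\infty)$ belongs to $\mathcal{BF}$ if and only if for some (and hence for all) $c>0$, $$\lambda\mapsto\theta_c\Phi(\lambda)=\Phi(c)-\Phi(0)+\Phi(\lambda)-\Phi(\lambda+c)\in\mathcal{BF}_b^0.$$ (b) In this case, the sequence of functions $\theta_{nc}\Phi$, $n\ge1$, converges pointwise, locally uniformly, to a function in $\mathcal{BF}$, null in zero, that does not depend on $c$. More precisely, $$\Phi(\lambda)=\Phi(0)+\lambda\lim_{x\to\infty}\frac{\Phi(x)}{x}+\lim_{n\to\infty}\theta_{nc}\Phi(\lambda),\quad\lambda\ge0.$$ The same holds for the successive derivatives: the derivatives of each order of $\theta_{nc}\Phi$ converge pointwise, locally uniformly (on $(0,\infty)$), to the corresponding derivatives of the limit.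
   Context: All functions are measurable. $\mathcal{BF}$ is the class of Bernstein functions: functions $\Phi:(0,\infty)\to[0,\infty)$, infinitely differentiable, with $(-1)^{n-1}\Phi^{(n)}(\lambda)\ge 0$ for all $\lambda>0$ and all integers $n\ge1$. Every such function has a continuous extension to $[0,\infty)$, with which it is identified. $\mathcal{BF}_b^0$ is the class of bounded Bernstein functions $\Phi$ with $\Phi(0)=0$; equivalently, functions $\Phi(\lambda)=\int_{(0,\infty)}(1-e^{-\lambda x})\,\mu(dx)$, $\lambda\ge 0$, with $\mu$ a positive measure on $(0,\infty)$ with $\mu((0,\infty))<\infty$. For any $c>0$ (in particular with $nc$ in place of $c$), $\theta_c\Phi(\lambda)=\Phi(c)-\Phi(0)+\Phi(\lambda)-\Phi(\lambda+c)$.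
   Formalization: In (a), "for some c" alone is false (Φ(x)=1+sin x, c=2π gives θ_cΦ=0 but Φ∉BF). Proved instead: Φ∈BF iff θ_cΦ∈BF_b^0 for all c>0; and iff this holds for some c>0 and, for every h≥0, Φ(x+h)−Φ(x) has a limit as x→∞. *)

theory Defs
  imports "HOL-Analysis.Analysis"
begin

text \<open>
  Functions on \<open>[0,\<infinity>)\<close> are represented by total functions on the reals; nothing below depends
  on their values on \<open>(-\<infinity>,0)\<close>: iterated derivatives are only taken at points of the open
  half-line, where they are determined by the values nearby.

  The last condition is the identification of a Bernstein function with its continuous
  extension to \<open>[0,\<infinity>)\<close>. It also forces \<open>f 0 \<ge> 0\<close>.
\<close>

definition BF :: "(real \<Rightarrow> real) set" where
  "BF = {f. (\<forall>x>0. f x \<ge> 0) \<and>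
            (\<forall>n. \<forall>x>0. (deriv ^^ n) f field_differentiable at x) \<and>
            (\<forall>n\<ge>1. \<forall>x>0. (-1) ^ (n - 1) * (deriv ^^ n) f x \<ge> 0) \<and>
            (f \<longlongrightarrow> f 0) (at_right 0)}"

definition BFb0 :: "(real \<Rightarrow> real) set" where
  "BFb0 = {f \<in> BF. bounded (f ` {0..}) \<and> f 0 = 0}"

definition theta :: "real \<Rightarrow> (real \<Rightarrow> real) \<Rightarrow> real \<Rightarrow> real" where
  "theta c f x = f c - f 0 + f x - f (x + c)"

definition locally_uniform_limit ::
    "real set \<Rightarrow> (nat \<Rightarrow> real \<Rightarrow> real) \<Rightarrow> (real \<Rightarrow> real) \<Rightarrow> bool" where
  "locally_uniform_limit S f g \<longleftrightarrow>
     (\<forall>x\<in>S. \<exists>U. openin (top_of_set S) U \<and> x \<in> U \<and> uniform_limit U f g sequentially)"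

text \<open>
  A single \<open>c > 0\<close> with \<open>theta c \<Phi> \<in> BFb0\<close> does not make \<open>\<Phi>\<close> a Bernstein function:
  \<open>theta c\<close> cannot see \<open>c\<close>-periodic summands of \<open>\<Phi>\<close>.
\<close>

lemma theta_in_BFb0_for_some_c_not_sufficient:
  defines "\<Phi> \<equiv> \<lambda>x::real. 1 + sin x"
  shows "\<Phi> \<in> borel_measurable (restrict_space borel {0..})" "\<forall>x\<ge>0. \<Phi> x \<ge> 0"
    "theta (2 * pi) \<Phi> \<in> BFb0" "\<Phi> \<notin> BF"
proof -
  show "\<Phi> \<in> borel_measurable (restrict_space borel {0..})"
    unfolding \<Phi>_def by (intro measurable_restrict_space1) measurable
  show "\<forall>x\<ge>0. \<Phi> x \<ge> 0"
    unfolding \<Phi>_def using sin_ge_minus_one by (metis add.commute neg_le_iff_le add_nonneg_nonneg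
        diff_ge_0_iff_ge diff_minus_eq_add)
  have th: "theta (2 * pi) \<Phi> = (\<lambda>_. 0)"
    by (auto simp: theta_def \<Phi>_def fun_eq_iff)
  have d: "(deriv ^^ n) (\<lambda>_::real. 0::real) = (\<lambda>_. 0)" for n
    by (induction n) auto
  show "theta (2 * pi) \<Phi> \<in> BFb0"
    unfolding th BFb0_def BF_def by (auto simp: d image_constant_conv)
  have "(\<Phi> has_field_derivative cos pi) (at pi)"
    unfolding \<Phi>_def by (auto intro!: derivative_eq_intros)
  then have "deriv \<Phi> pi = -1"
    by (simp add: DERIV_imp_deriv)
  then have "\<not> (-1) ^ (1 - 1) * (deriv ^^ 1) \<Phi> pi \<ge> 0"
    by simp
  then show "\<Phi> \<notin> BF"
    unfolding BF_def using pi_gt_zero by blast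
qed

end

theory Submission
  imports Defs
begin

text \<open>
  For a Bernstein function \<open>\<Phi>\<close> the first derivative, like every other derivative up to sign, is
  nonnegative and nonincreasing. Hence \<open>\<Phi> x - \<Phi> (x + c)\<close> has derivatives of the signs of those of
  \<open>\<Phi>\<close>, and \<open>theta c \<Phi>\<close> is again a Bernstein function, bounded by \<open>\<Phi> c - \<Phi> 0\<close>
  (\<open>theta_of_BF\<close>).

  Conversely, \<open>theta h \<Phi> \<in> BFb0\<close> is monotone and bounded, so the increment
  \<open>\<Phi> (x + h) - \<Phi> x = \<Phi> h - \<Phi> 0 - theta h \<Phi> x\<close> converges as \<open>x\<close> tends to infinity. Thus both
  characterisations reduce to the second one: a single \<open>c\<close> together with convergent increments,
  a condition that excludes nonconstant periodic summands. The limits of the increments are additive in \<open>h\<close>,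
  and nonnegative because \<open>\<Phi>\<close> is, hence equal to \<open>h * L\<close>. Put \<open>B = theta c \<Phi>\<close>. The sum of the
  increments \<open>B (x + k * c) - B (k * c)\<close> over \<open>k < n\<close> telescopes to \<open>theta (n * c) \<Phi> x\<close>, which
  tends to \<open>\<Phi> x - \<Phi> 0 - x * L\<close>, so that

    \<open>\<Phi> x = \<Phi> 0 + x * L + (\<Sum>k. B (x + k * c) - B (k * c))\<close>.

  Since the derivatives of \<open>B\<close> are monotone and have bounded primitives on every \<open>[a,\<infinity>)\<close> with
  \<open>a > 0\<close>, their sums along arithmetic progressions converge, uniformly on \<open>[a,\<infinity>)\<close>. The
  series can be differentiated term by term and gives all derivatives of \<open>\<Phi>\<close> with their signs
  (\<open>BF_if_theta_and_increments\<close>).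

  For the representation, the limit function is \<open>\<Psi> x = \<Phi> x - \<Phi> 0 - x * L\<close>, where \<open>L\<close> is the limit
  of the first derivative at infinity. The derivative of order \<open>k + 1\<close> of
  \<open>theta (n * c) \<Phi> - \<Psi>\<close> at \<open>x\<close> is the limit at infinity of that derivative of \<open>\<Phi>\<close> (which is \<open>0\<close>
  for \<open>k \<ge> 1\<close>) minus its value at \<open>x + n * c\<close>. By monotonicity it is largest in modulus as \<open>x\<close>
  approaches \<open>0\<close>; this is why the convergence of the derivatives is uniform on the whole open
  half-line (\<open>BF_theta_convergence\<close>).
\<close>

section \<open>Bernstein functions and their alternating derivatives\<close>

text \<open>
  The signs are chosen so that \<open>alt_deriv f n\<close> is nonnegative for all \<open>n\<close> when \<open>f\<close> is a Bernstein
  function. As the derivative of \<open>alt_deriv f n\<close> is \<open>- alt_deriv f (Suc n)\<close>, one monotonicity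
  argument then serves all orders.
\<close>

definition alt_deriv :: "(real \<Rightarrow> real) \<Rightarrow> nat \<Rightarrow> real \<Rightarrow> real" where
  "alt_deriv f n x = (-1) ^ n * (deriv ^^ Suc n) f x"

lemma iterated_deriv_eqI:
  fixes f :: "real \<Rightarrow> real"
  assumes d0: "\<And>x. x > 0 \<Longrightarrow> (f has_field_derivative g 0 x) (at x)"
    and dS: "\<And>n x. x > 0 \<Longrightarrow> (g n has_field_derivative - g (Suc n) x) (at x)"
    and x: "x > 0"
  shows "(deriv ^^ Suc n) f x = (-1) ^ n * g n x"
  using x
proof (induction n arbitrary: x)
  case 0
  then show ?case using d0 by (simp add: DERIV_imp_deriv)
next
  case (Suc n)
  have ev: "eventually (\<lambda>y. (deriv ^^ Suc n) f y = (-1) ^ n * g n y) (nhds x)"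
    using eventually_nhds_in_open[of "{0<..}" x] Suc.prems
    by (auto elim!: eventually_mono simp del: funpow.simps simp: Suc.IH)
  have "(deriv ^^ Suc (Suc n)) f x = deriv ((deriv ^^ Suc n) f) x"
    by simp
  also have "\<dots> = deriv (\<lambda>y. (-1) ^ n * g n y) x"
    by (rule deriv_cong_ev[OF ev refl])
  also have "\<dots> = (-1) ^ n * (- g (Suc n) x)"
    by (intro DERIV_imp_deriv DERIV_cmult dS Suc.prems)
  finally show ?case by simp
qed

lemma mono_at_zeroI:
  fixes f :: "real \<Rightarrow> real"
  assumes d: "\<And>x. x > 0 \<Longrightarrow> (f has_field_derivative g x) (at x)"
    and nn: "\<And>x. x > 0 \<Longrightarrow> g x \<ge> 0"
    and lim: "(f \<longlongrightarrow> f 0) (at_right 0)"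
    and xy: "0 \<le> x" "x \<le> y"
  shows "f x \<le> f y"
proof (rule DERIV_nonneg_imp_increasing_open[OF xy(2)])
  show "\<exists>D. (f has_real_derivative D) (at z) \<and> 0 \<le> D" if "x < z" "z < y" for z
    using d nn xy that by (intro exI[of _ "g z"]) auto
  have "continuous (at z within {x..y}) f" if "z \<in> {x..y}" for z
  proof (cases "z = 0")
    case True
    then have "(f \<longlongrightarrow> f z) (at z within {x..y})"
      using lim xy that
      by (intro tendsto_within_subset[where S = "{0..}" and T = "{x..y}"]) (auto simp: at_within_Ici_at_right)
    then show ?thesis by (simp add: continuous_within)
  next
    case False
    then show ?thesis
      using d[of z] xy that DERIV_isCont continuous_at_imp_continuous_at_within by fastforce
  qed
  then show "continuous_on {x..y} f"
    by (simp add: continuous_on_eq_continuous_within)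
qed

text \<open>
  Nonnegativity on \<open>(0,\<infinity>)\<close> comes for free from \<open>f 0 \<ge> 0\<close>, since \<open>f\<close> is nondecreasing. The
  family \<open>g\<close> is a candidate for all the derivatives at once, up to sign.
\<close>

lemma BF_I:
  assumes d0: "\<And>x. x > 0 \<Longrightarrow> (f has_field_derivative g 0 x) (at x)"
    and dS: "\<And>n x. x > 0 \<Longrightarrow> (g n has_field_derivative - g (Suc n) x) (at x)"
    and nn: "\<And>n x. x > 0 \<Longrightarrow> g n x \<ge> 0"
    and lim: "(f \<longlongrightarrow> f 0) (at_right 0)"
    and f0: "f 0 \<ge> 0"
  shows "f \<in> BF"
proof -
  have eq: "(deriv ^^ Suc n) f x = (-1) ^ n * g n x" if "x > 0" for n x
    by (rule iterated_deriv_eqI[where g = g, OF d0 dS that])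
  have "f x \<ge> 0" if "x > 0" for x
    using mono_at_zeroI[OF d0 nn lim, of 0 x] f0 that by simp
  moreover have "(deriv ^^ n) f field_differentiable at x" if "x > 0" for n x
  proof (cases n)
    case 0
    then show ?thesis using d0[OF that] by (auto simp: field_differentiable_def)
  next
    case (Suc m)
    have ev: "eventually (\<lambda>y. (deriv ^^ n) f y = (-1) ^ m * g m y) (nhds x)"
      using eventually_nhds_in_open[of "{0<..}" x] that unfolding Suc
      by (auto elim!: eventually_mono simp del: funpow.simps simp: eq)
    have "((\<lambda>y. (-1) ^ m * g m y) has_field_derivative (-1) ^ m * (- g (Suc m) x)) (at x)"
      by (intro DERIV_cmult dS that)
    then show ?thesis
      unfolding field_differentiable_def DERIV_cong_ev[OF refl ev refl] by blast
  qed
  moreover have "(-1) ^ (n - 1) * (deriv ^^ n) f x \<ge> 0" if "n \<ge> 1" "x > 0" for n x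
  proof -
    obtain m where m: "n = Suc m" using \<open>n \<ge> 1\<close> by (cases n) auto
    show ?thesis
      using nn[OF \<open>x > 0\<close>, of m] unfolding m eq[OF \<open>x > 0\<close>]
      by (simp add: minus_one_power_iff)
  qed
  ultimately show ?thesis
    using lim by (auto simp: BF_def)
qed

lemma BF_alt_deriv_nonneg: "f \<in> BF \<Longrightarrow> x > 0 \<Longrightarrow> alt_deriv f n x \<ge> 0"
  unfolding BF_def alt_deriv_def using diff_Suc_1 by (smt (verit) le_add1 mem_Collect_eq plus_1_eq_Suc)

lemma BF_has_deriv:
  assumes "f \<in> BF" "x > 0"
  shows "(f has_field_derivative alt_deriv f 0 x) (at x)"
proof -
  have "(deriv ^^ 0) f field_differentiable at x"
    using assms unfolding BF_def by blast
  then show ?thesis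
    by (simp add: alt_deriv_def DERIV_deriv_iff_field_differentiable)
qed

lemma BF_alt_deriv_has_deriv:
  assumes "f \<in> BF" "x > 0"
  shows "(alt_deriv f n has_field_derivative - alt_deriv f (Suc n) x) (at x)"
proof -
  have "(deriv ^^ Suc n) f field_differentiable at x"
    using assms unfolding BF_def by blast
  then have "((deriv ^^ Suc n) f has_field_derivative (deriv ^^ Suc (Suc n)) f x) (at x)"
    by (simp add: DERIV_deriv_iff_field_differentiable)
  then have "((\<lambda>x. (-1) ^ n * (deriv ^^ Suc n) f x) has_field_derivative
      (-1) ^ n * (deriv ^^ Suc (Suc n)) f x) (at x)"
    by (rule DERIV_cmult)
  then show ?thesis
    by (simp add: alt_deriv_def[abs_def])
qed

lemma BF_tendsto_at_right: "f \<in> BF \<Longrightarrow> (f \<longlongrightarrow> f 0) (at_right 0)"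
  by (simp add: BF_def)

lemma BF_nonneg_0:
  assumes "f \<in> BF"
  shows "f 0 \<ge> 0"
proof (rule tendsto_lowerbound[OF BF_tendsto_at_right[OF assms]])
  show "\<forall>\<^sub>F x in at_right 0. 0 \<le> f x"
    using assms unfolding BF_def
    by (auto intro!: eventually_mono[OF eventually_at_right_less[of "0::real"]])
qed simp

lemma BF_mono: "f \<in> BF \<Longrightarrow> 0 \<le> x \<Longrightarrow> x \<le> y \<Longrightarrow> f x \<le> f y"
  by (rule mono_at_zeroI[where g = "alt_deriv f 0"])
    (auto intro: BF_has_deriv BF_alt_deriv_nonneg BF_tendsto_at_right)

lemma BF_alt_deriv_antimono:
  assumes "f \<in> BF" "0 < x" "x \<le> y"
  shows "alt_deriv f n y \<le> alt_deriv f n x"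
proof (rule DERIV_nonpos_imp_nonincreasing[OF assms(3)])
  show "\<exists>D. (alt_deriv f n has_real_derivative D) (at z) \<and> D \<le> 0" if "x \<le> z" "z \<le> y" for z
    using BF_alt_deriv_has_deriv[OF assms(1), of z] BF_alt_deriv_nonneg[OF assms(1), of z] assms that
    by force
qed

text \<open>
  The derivatives of \<open>theta c f\<close> are \<open>alt_deriv f n x - alt_deriv f n (x + c)\<close>, up to the same
  sign, and \<open>alt_deriv f n\<close> is nonincreasing. So \<open>theta c\<close> preserves the sign pattern.
\<close>

lemma theta_of_BF:
  assumes f: "f \<in> BF" and c: "c \<ge> 0"
  shows "theta c f \<in> BFb0"
    and "x > 0 \<Longrightarrow> (deriv ^^ Suc n) (theta c f) x = (-1) ^ n * (alt_deriv f n x - alt_deriv f n (x + c))"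
proof -
  let ?g = "\<lambda>n x. alt_deriv f n x - alt_deriv f n (x + c)"
  have d0: "(theta c f has_field_derivative ?g 0 x) (at x)" if "x > 0" for x
    unfolding theta_def[abs_def] using that c
    by (auto intro!: derivative_eq_intros BF_has_deriv[OF f]
        DERIV_shift[THEN iffD1, OF BF_has_deriv[OF f]])
  have dS: "(?g n has_field_derivative - ?g (Suc n) x) (at x)" if "x > 0" for n x
    using that c
    by (auto intro!: derivative_eq_intros BF_alt_deriv_has_deriv[OF f]
        DERIV_shift[THEN iffD1, OF BF_alt_deriv_has_deriv[OF f]])
  have lim: "(theta c f \<longlongrightarrow> theta c f 0) (at_right 0)"
  proof (cases "c = 0")
    case False
    then have "isCont f (0 + c)"
      using BF_has_deriv[OF f, of c] c by (auto intro: DERIV_isCont)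
    then have "((\<lambda>x. f (x + c)) \<longlongrightarrow> f (0 + c)) (at_right 0)"
      by (intro isCont_tendsto_compose[of _ f] tendsto_intros)
    then show ?thesis
      unfolding theta_def[abs_def] by (intro tendsto_intros BF_tendsto_at_right[OF f]) simp
  qed (simp add: theta_def[abs_def])
  have BF: "theta c f \<in> BF"
    using c by (intro BF_I[where g = ?g] d0 dS lim)
      (auto intro!: BF_alt_deriv_antimono[OF f] simp: theta_def)
  have "norm (theta c f x) \<le> f c - f 0" if "x \<ge> 0" for x
  proof -
    have "f x \<le> f (x + c)" "theta c f 0 \<le> theta c f x"
      using that c by (auto intro: BF_mono f BF)
    then show ?thesis by (simp add: theta_def)
  qed
  then have "bounded (theta c f ` {0..})"
    unfolding bounded_iff by blast
  then show "theta c f \<in> BFb0"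
    using BF by (simp add: BFb0_def theta_def)
  show "(deriv ^^ Suc n) (theta c f) x = (-1) ^ n * ?g n x" if "x > 0"
    by (rule iterated_deriv_eqI[where g = ?g, OF d0 dS that])
qed

section \<open>Behaviour at infinity\<close>

lemma antimono_bounded_below_tendsto:
  fixes g :: "real \<Rightarrow> real"
  assumes anti: "\<And>x y. 0 < x \<Longrightarrow> x \<le> y \<Longrightarrow> g y \<le> g x"
    and bd: "\<And>x. 0 < x \<Longrightarrow> b \<le> g x"
  shows "\<exists>l. (g \<longlongrightarrow> l) at_top \<and> (\<forall>x>0. l \<le> g x) \<and> b \<le> l"
proof -
  define l where "l = Inf (g ` {0<..})"
  have bb: "bdd_below (g ` {0<..})"
    using bd by (intro bdd_belowI[of _ b]) auto
  have le: "l \<le> g x" if "x > 0" for x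
    unfolding l_def using bb that by (intro cInf_lower) auto
  have "(g \<longlongrightarrow> l) at_top"
  proof (rule order_tendstoI)
    fix a assume "a < l"
    then show "\<forall>\<^sub>F x in at_top. a < g x"
      using le by (intro eventually_mono[OF eventually_gt_at_top[of 0]]) (meson less_le_trans)
  next
    fix a assume "l < a"
    then obtain x where x: "x > 0" "g x < a"
      unfolding l_def using bb by (subst (asm) cInf_less_iff) auto
    then show "\<forall>\<^sub>F y in at_top. g y < a"
      using anti by (intro eventually_mono[OF eventually_ge_at_top[of x]]) (meson le_less_trans)
  qed
  moreover have "b \<le> l"
    unfolding l_def using bd by (intro cInf_greatest) auto
  ultimately show ?thesis using le by blast
qed

lemma BF_alt_deriv_tendsto:
  assumes "f \<in> BF"
  shows "\<exists>l. (alt_deriv f n \<longlongrightarrow> l) at_top \<and> (\<forall>x>0. l \<le> alt_deriv f n x) \<and> 0 \<le> l"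
  by (rule antimono_bounded_below_tendsto)
    (auto intro: BF_alt_deriv_antimono BF_alt_deriv_nonneg assms)

lemma BFb0_tendsto:
  assumes "f \<in> BFb0"
  shows "\<exists>l. (f \<longlongrightarrow> l) at_top"
proof -
  obtain K where K: "norm (f x) \<le> K" if "x \<ge> 0" for x
    using assms unfolding BFb0_def bounded_iff by auto
  have "\<exists>l. ((\<lambda>x. - f x) \<longlongrightarrow> l) at_top \<and> (\<forall>x>0. l \<le> - f x) \<and> - K \<le> l"
  proof (rule antimono_bounded_below_tendsto)
    show "- f y \<le> - f x" if "0 < x" "x \<le> y" for x y
      using assms that by (auto simp: BFb0_def intro: BF_mono)
    show "- K \<le> - f x" if "0 < x" for x
      using K[of x] that by simp
  qed
  then show ?thesis
    using tendsto_minus_cancel_left by blast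
qed

text \<open>
  By the mean value theorem the increment is \<open>s\<close> times a value of \<open>g\<close> between \<open>x\<close> and \<open>x + s\<close>.
\<close>

lemma increment_tendsto:
  fixes h :: "real \<Rightarrow> real"
  assumes d: "\<And>x. x > 0 \<Longrightarrow> (h has_field_derivative g x) (at x)"
    and lim: "(g \<longlongrightarrow> l) at_top" and s: "s \<ge> 0"
  shows "((\<lambda>x. h (x + s) - h x) \<longlongrightarrow> s * l) at_top"
proof (cases "s = 0")
  case False
  with s have s: "s > 0" by simp
  have "\<exists>z>x. z < x + s \<and> h (x + s) - h x = (x + s - x) * g z" if "x > 0" for x
    using s that by (intro MVT2 d) auto
  then obtain z where z: "z x > x" "h (x + s) - h x = s * g (z x)" if "x > 0" for x
    by (metis add_diff_cancel_left')
  have "filterlim z at_top at_top"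
    by (rule filterlim_at_top_mono[OF filterlim_ident])
      (auto intro!: eventually_mono[OF eventually_gt_at_top[of 0]] less_imp_le z)
  then have "((\<lambda>x. s * g (z x)) \<longlongrightarrow> s * l) at_top"
    by (intro tendsto_mult_left filterlim_compose[OF lim])
  then show ?thesis
    by (rule Lim_transform_eventually)
      (auto intro!: eventually_mono[OF eventually_gt_at_top[of 0]] simp: z)
qed simp

text \<open>
  If \<open>alt_deriv f (Suc n)\<close> tends to \<open>l\<close>, the increments of \<open>alt_deriv f n\<close> over unit steps tend to
  \<open>- l\<close>. They also tend to \<open>0\<close>, because \<open>alt_deriv f n\<close> itself converges.
\<close>

lemma BF_alt_deriv_Suc_tendsto_0:
  assumes f: "f \<in> BF"
  shows "(alt_deriv f (Suc n) \<longlongrightarrow> 0) at_top"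
proof -
  obtain l where l: "(alt_deriv f (Suc n) \<longlongrightarrow> l) at_top"
    using BF_alt_deriv_tendsto[OF f] by blast
  obtain m where m: "(alt_deriv f n \<longlongrightarrow> m) at_top"
    using BF_alt_deriv_tendsto[OF f] by blast
  have "((\<lambda>x. alt_deriv f n (x + 1) - alt_deriv f n x) \<longlongrightarrow> 1 * - l) at_top"
    by (rule increment_tendsto[OF BF_alt_deriv_has_deriv[OF f]]) (auto intro: tendsto_minus l)
  moreover have "filterlim (\<lambda>x::real. x + 1) at_top at_top"
    by (rule filterlim_at_top_mono[OF filterlim_ident]) simp
  then have "((\<lambda>x. alt_deriv f n (x + 1) - alt_deriv f n x) \<longlongrightarrow> m - m) at_top"
    by (intro tendsto_diff m filterlim_compose[OF m])
  ultimately have "1 * - l = m - m"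
    by (rule tendsto_unique[rotated]) simp
  with l show ?thesis by simp
qed

lemma BF_divide_tendsto:
  assumes f: "f \<in> BF" and L: "(alt_deriv f 0 \<longlongrightarrow> L) at_top"
  shows "((\<lambda>x. f x / x) \<longlongrightarrow> L) at_top"
proof (rule lhospital_at_top_at_top[where f' = "alt_deriv f 0" and g' = "\<lambda>_. 1"])
  show "\<forall>\<^sub>F x in at_top. (f has_real_derivative alt_deriv f 0 x) (at x)"
    by (auto intro!: eventually_mono[OF eventually_gt_at_top[of 0]] BF_has_deriv f)
qed (use L in \<open>auto simp: filterlim_ident\<close>)


section \<open>A Bernstein function as the limit of its truncations\<close>

text \<open>
  Only the first derivative changes. It is lowered by one of its lower bounds, so its sign survives.
\<close>

lemma BF_remove_linear_part:
  assumes f: "f \<in> BF" and L: "\<And>x. x > 0 \<Longrightarrow> L \<le> alt_deriv f 0 x"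
  defines "\<Psi> \<equiv> \<lambda>x. f x - f 0 - x * L"
  shows "\<Psi> \<in> BF"
    and "x > 0 \<Longrightarrow> (deriv ^^ Suc n) \<Psi> x = (-1) ^ n * (alt_deriv f n x - (if n = 0 then L else 0))"
proof -
  let ?g = "\<lambda>n x. alt_deriv f n x - (if n = 0 then L else 0)"
  have d0: "(\<Psi> has_field_derivative ?g 0 x) (at x)" if "x > 0" for x
    unfolding \<Psi>_def using that by (auto intro!: derivative_eq_intros BF_has_deriv[OF f])
  have dS: "(?g n has_field_derivative - ?g (Suc n) x) (at x)" if "x > 0" for n x
    using that by (auto intro!: derivative_eq_intros BF_alt_deriv_has_deriv[OF f])
  have lim: "(\<Psi> \<longlongrightarrow> f 0 - f 0 - 0 * L) (at_right 0)"
    unfolding \<Psi>_def by (intro tendsto_intros BF_tendsto_at_right f)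
  show "\<Psi> \<in> BF"
  proof (rule BF_I[where g = ?g, OF d0 dS])
    show "?g n x \<ge> 0" if "x > 0" for n x
      using L BF_alt_deriv_nonneg[OF f that, of n] that by simp
    show "(\<Psi> \<longlongrightarrow> \<Psi> 0) (at_right 0)" "0 \<le> \<Psi> 0"
      using lim by (simp_all add: \<Psi>_def)
  qed
  show "(deriv ^^ Suc n) \<Psi> x = (-1) ^ n * ?g n x" if "x > 0"
    by (rule iterated_deriv_eqI[where g = ?g, OF d0 dS that])
qed

lemma filterlim_real_mult_at_top:
  "c > 0 \<Longrightarrow> filterlim (\<lambda>n. real n * c) at_top sequentially"
  by (rule filterlim_at_top_mult_tendsto_pos[OF tendsto_const _ filterlim_real_sequentially])

lemma uniform_limit_dominatedI:
  fixes f :: "nat \<Rightarrow> real \<Rightarrow> real"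
  assumes "\<forall>\<^sub>F n in sequentially. \<forall>x\<in>S. \<bar>f n x - g x\<bar> \<le> e n"
    and "e \<longlonglongrightarrow> 0"
  shows "uniform_limit S f g sequentially"
proof (rule uniform_limitI)
  fix r :: real assume "r > 0"
  then have "\<forall>\<^sub>F n in sequentially. e n < r"
    by (rule order_tendstoD[OF assms(2)])
  with assms(1) show "\<forall>\<^sub>F n in sequentially. \<forall>x\<in>S. dist (f n x) (g x) < r"
    by eventually_elim (auto simp: dist_real_def intro: le_less_trans)
qed

text \<open>
  The expression inside the modulus is \<open>x * L - (f (x + y) - f y)\<close>, and this increment of \<open>f\<close> lies
  between \<open>x * L\<close> and \<open>x * alt_deriv f 0 y\<close>.
\<close>

lemma theta_error_bound:
  assumes f: "f \<in> BF" and L: "\<And>x. x > 0 \<Longrightarrow> L \<le> alt_deriv f 0 x"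
    and xy: "0 \<le> x" "x \<le> b" "0 < y"
  shows "\<bar>theta y f x - (f x - f 0 - x * L)\<bar> \<le> b * (alt_deriv f 0 y - L)"
proof (cases "x = 0")
  case True
  then show ?thesis using L[of y] xy by (simp add: theta_def)
next
  case False
  have "\<exists>z>y. z < y + x \<and> f (y + x) - f y = (y + x - y) * alt_deriv f 0 z"
    using False xy by (intro MVT2 BF_has_deriv f) auto
  then obtain z where z: "z > y" "f (y + x) - f y = x * alt_deriv f 0 z"
    by auto
  have "theta y f x - (f x - f 0 - x * L) = - (x * (alt_deriv f 0 z - L))"
    using z(2) by (simp add: theta_def algebra_simps)
  then have "\<bar>theta y f x - (f x - f 0 - x * L)\<bar> = x * (alt_deriv f 0 z - L)"
    using L[of z] z(1) xy by simp
  also have "\<dots> \<le> b * (alt_deriv f 0 y - L)"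
    using L[of z] z(1) xy BF_alt_deriv_antimono[OF f xy(3), of z 0] by (intro mult_mono) auto
  finally show ?thesis .
qed

text \<open>
  For the derivatives of order \<open>k + 1\<close> the error at \<open>x\<close> is, up to sign, the difference between
  \<open>alt_deriv f k (x + n * c)\<close> and the limit of \<open>alt_deriv f k\<close> at infinity. Monotonicity bounds it
  by the same difference at \<open>n * c\<close>, which is independent of \<open>x\<close>.
\<close>

lemma BF_theta_convergence:
  assumes f: "f \<in> BF" and L: "(alt_deriv f 0 \<longlongrightarrow> L) at_top" "\<And>x. x > 0 \<Longrightarrow> L \<le> alt_deriv f 0 x"
    and c: "c > 0"
  defines "\<Psi> \<equiv> \<lambda>x. f x - f 0 - x * L"
  shows "uniform_limit {0..b} (\<lambda>n. theta (real n * c) f) \<Psi> sequentially"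
    and "uniform_limit {0<..} (\<lambda>n. (deriv ^^ Suc k) (theta (real n * c) f)) ((deriv ^^ Suc k) \<Psi>) sequentially"
proof -
  have pos: "\<forall>\<^sub>F n in sequentially. 0 < real n * c"
    using c by (auto intro!: eventually_mono[OF eventually_gt_at_top[of 0]])
  have at_top: "filterlim (\<lambda>n. real n * c) at_top sequentially"
    by (rule filterlim_real_mult_at_top[OF c])
  show "uniform_limit {0..b} (\<lambda>n. theta (real n * c) f) \<Psi> sequentially"
  proof (rule uniform_limit_dominatedI)
    show "\<forall>\<^sub>F n in sequentially. \<forall>x\<in>{0..b}.
        \<bar>theta (real n * c) f x - \<Psi> x\<bar> \<le> b * (alt_deriv f 0 (real n * c) - L)"
      using pos by eventually_elim (auto simp: \<Psi>_def intro!: theta_error_bound f L)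
    have "(\<lambda>n. b * (alt_deriv f 0 (real n * c) - L)) \<longlonglongrightarrow> b * (L - L)"
      by (intro tendsto_intros filterlim_compose[OF L(1)] at_top)
    then show "(\<lambda>n. b * (alt_deriv f 0 (real n * c) - L)) \<longlonglongrightarrow> 0"
      by simp
  qed
  define l where "l = (if k = 0 then L else 0)"
  have l: "(alt_deriv f k \<longlongrightarrow> l) at_top"
    using L BF_alt_deriv_Suc_tendsto_0[OF f] by (cases k) (simp_all add: l_def)
  have l_le: "l \<le> alt_deriv f k x" if "x > 0" for x
    using L BF_alt_deriv_nonneg[OF f] that by (simp add: l_def)
  show "uniform_limit {0<..} (\<lambda>n. (deriv ^^ Suc k) (theta (real n * c) f)) ((deriv ^^ Suc k) \<Psi>) sequentially"
  proof (rule uniform_limit_dominatedI)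
    have "\<bar>(deriv ^^ Suc k) (theta y f) x - (deriv ^^ Suc k) \<Psi> x\<bar> \<le> alt_deriv f k y - l"
      if "x > 0" "y > 0" for x y
    proof -
      have "(deriv ^^ Suc k) (theta y f) x = (-1) ^ k * (alt_deriv f k x - alt_deriv f k (x + y))"
        using that by (intro theta_of_BF f) auto
      moreover have "(deriv ^^ Suc k) \<Psi> x = (-1) ^ k * (alt_deriv f k x - l)"
        unfolding \<Psi>_def l_def using that by (intro BF_remove_linear_part f L)
      ultimately have "\<bar>(deriv ^^ Suc k) (theta y f) x - (deriv ^^ Suc k) \<Psi> x\<bar>
          = \<bar>(-1) ^ k * (l - alt_deriv f k (x + y))\<bar>"
        by (simp only: flip: right_diff_distrib) simp
      also have "\<dots> = alt_deriv f k (x + y) - l"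
        using l_le[of "x + y"] that by (simp add: abs_mult)
      also have "\<dots> \<le> alt_deriv f k y - l"
        using BF_alt_deriv_antimono[OF f, of y "x + y" k] that by simp
      finally show ?thesis .
    qed
    with pos show "\<forall>\<^sub>F n in sequentially. \<forall>x\<in>{0<..}.
        \<bar>(deriv ^^ Suc k) (theta (real n * c) f) x - (deriv ^^ Suc k) \<Psi> x\<bar>
        \<le> alt_deriv f k (real n * c) - l"
      by (auto elim!: eventually_mono simp del: funpow.simps)
    have "(\<lambda>n. alt_deriv f k (real n * c) - l) \<longlonglongrightarrow> l - l"
      by (intro tendsto_intros filterlim_compose[OF l] at_top)
    then show "(\<lambda>n. alt_deriv f k (real n * c) - l) \<longlonglongrightarrow> 0"
      by simp
  qed
qed

section \<open>Increments of a nonnegative function at infinity\<close>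

text \<open>
  A negative limit would drive \<open>f\<close> below \<open>0\<close> along an arithmetic progression of step \<open>h\<close>.
\<close>

lemma nonneg_increment_limit_nonneg:
  fixes f :: "real \<Rightarrow> real"
  assumes nn: "\<And>x. x \<ge> 0 \<Longrightarrow> f x \<ge> 0" and h: "h \<ge> 0"
    and lim: "((\<lambda>x. f (x + h) - f x) \<longlongrightarrow> l) at_top"
  shows "l \<ge> 0"
proof (rule ccontr)
  assume "\<not> l \<ge> 0"
  then have "\<forall>\<^sub>F x in at_top. f (x + h) - f x < l / 2"
    by (intro order_tendstoD(2)[OF lim]) simp
  then obtain X0 where X0: "f (x + h) - f x < l / 2" if "x \<ge> X0" for x
    unfolding eventually_at_top_linorder by blast
  define X where "X = max X0 0"
  have le: "f (X + real n * h) \<le> f X + real n * (l / 2)" for n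
  proof (induction n)
    case (Suc n)
    have "X0 \<le> X + real n * h"
      using h by (simp add: X_def add_increasing2)
    have "f (X + real (Suc n) * h) = f (X + real n * h + h)"
      by (simp add: algebra_simps)
    also have "\<dots> \<le> f (X + real n * h) + l / 2"
      using X0[OF \<open>X0 \<le> X + real n * h\<close>] by simp
    also have "\<dots> \<le> f X + real (Suc n) * (l / 2)"
      using Suc by (simp add: field_simps)
    finally show ?case .
  qed simp
  obtain n where n: "f X < real n * (- l / 2)"
    using reals_Archimedean3[of "- l / 2"] \<open>\<not> l \<ge> 0\<close> by auto
  have "f (X + real n * h) \<ge> 0"
    using h by (intro nn) (simp add: X_def)
  with le[of n] n show False by simp
qed

text \<open>
  Additivity and nonnegativity make \<open>l\<close> monotone. Comparing \<open>n * h\<close> with its integer part then gives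
  \<open>n * \<bar>l h - h * l 1\<bar> \<le> l 1\<close> for all \<open>n\<close>.
\<close>

lemma additive_nonneg_imp_linear:
  fixes l :: "real \<Rightarrow> real"
  assumes add: "\<And>x y. x \<ge> 0 \<Longrightarrow> y \<ge> 0 \<Longrightarrow> l (x + y) = l x + l y"
    and nn: "\<And>x. x \<ge> 0 \<Longrightarrow> l x \<ge> 0" and h: "h \<ge> 0"
  shows "l h = h * l 1"
proof -
  have mono: "l x \<le> l y" if "0 \<le> x" "x \<le> y" for x y
    using add[of x "y - x"] nn[of "y - x"] that by simp
  have l0: "l 0 = 0" using add[of 0 0] by simp
  have mult: "l (real n * x) = real n * l x" if "x \<ge> 0" for n x
  proof (induction n)
    case (Suc n)
    have "l (real (Suc n) * x) = l (real n * x + x)"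
      by (simp add: algebra_simps)
    then show ?case using Suc add[of "real n * x" x] that by (simp add: algebra_simps)
  qed (simp add: l0)
  have bound: "real n * \<bar>l h - h * l 1\<bar> \<le> l 1" for n
  proof -
    define m where "m = nat \<lfloor>real n * h\<rfloor>"
    have m: "real m \<le> real n * h" "real n * h \<le> real (Suc m)"
      using h by (simp_all add: m_def) linarith
    have "real m * l 1 \<le> real n * l h"
      using mono[OF _ m(1)] mult[of 1 m] mult[OF h, of n] by simp
    moreover have "real n * l h \<le> real (Suc m) * l 1"
      using mono[OF _ m(2)] mult[of 1 "Suc m"] mult[OF h, of n] h by simp
    moreover have "real m * l 1 \<le> real n * h * l 1" "real n * h * l 1 \<le> real (Suc m) * l 1"
      using m nn[of 1] by (auto intro!: mult_right_mono)
    moreover have "real (Suc m) * l 1 = real m * l 1 + l 1"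
      by (simp add: distrib_right)
    ultimately have "\<bar>real n * l h - real n * h * l 1\<bar> \<le> l 1"
      by linarith
    moreover have "real n * l h - real n * h * l 1 = real n * (l h - h * l 1)"
      by (simp only: right_diff_distrib mult.assoc)
    ultimately show ?thesis
      by (simp only: abs_mult abs_of_nat)
  qed
  have "\<bar>l h - h * l 1\<bar> \<le> 0"
  proof (rule ccontr)
    assume "\<not> ?thesis"
    then obtain n where "l 1 < real n * \<bar>l h - h * l 1\<bar>"
      using reals_Archimedean3[of "\<bar>l h - h * l 1\<bar>"] by auto
    with bound[of n] show False by simp
  qed
  then show ?thesis by simp
qed

lemma nonneg_increment_limit_linear:
  fixes f :: "real \<Rightarrow> real"
  assumes nn: "\<And>x. x \<ge> 0 \<Longrightarrow> f x \<ge> 0"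
    and lim: "\<And>h. h \<ge> 0 \<Longrightarrow> \<exists>l. ((\<lambda>x. f (x + h) - f x) \<longlongrightarrow> l) at_top"
  obtains L where "L \<ge> 0" "\<And>h. h \<ge> 0 \<Longrightarrow> ((\<lambda>x. f (x + h) - f x) \<longlongrightarrow> h * L) at_top"
proof -
  from lim obtain l where l: "((\<lambda>x. f (x + h) - f x) \<longlongrightarrow> l h) at_top" if "h \<ge> 0" for h
    by metis
  have l_nonneg: "l h \<ge> 0" if "h \<ge> 0" for h
    by (rule nonneg_increment_limit_nonneg[OF nn that l[OF that]])
  have add: "l (h + k) = l h + l k" if "h \<ge> 0" "k \<ge> 0" for h k
  proof -
    have "filterlim (\<lambda>x. x + h) at_top at_top"
      by (rule filterlim_at_top_mono[OF filterlim_ident]) (simp add: that)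
    then have "((\<lambda>x. (f (x + h + k) - f (x + h)) + (f (x + h) - f x)) \<longlongrightarrow> l k + l h) at_top"
      using that by (intro tendsto_add filterlim_compose[OF l[of k]] l)
    then have "((\<lambda>x. f (x + (h + k)) - f x) \<longlongrightarrow> l k + l h) at_top"
      by (simp add: add.assoc)
    moreover have "((\<lambda>x. f (x + (h + k)) - f x) \<longlongrightarrow> l (h + k)) at_top"
      using that by (intro l) simp
    ultimately have "l k + l h = l (h + k)"
      by (rule tendsto_unique[rotated]) simp
    then show ?thesis by simp
  qed
  have linear: "l h = h * l 1" if "h \<ge> 0" for h
    by (rule additive_nonneg_imp_linear[OF add l_nonneg that])
  show thesis
  proof (rule that[of "l 1"])
    show "((\<lambda>x. f (x + h) - f x) \<longlongrightarrow> h * l 1) at_top" if "h \<ge> 0" for h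
      using l[OF that] linear[OF that] by simp
  qed (simp add: l_nonneg)
qed


section \<open>Recovering a Bernstein function from one difference\<close>

text \<open>
  The integral test: \<open>c * g (a + (k + 1) * c)\<close> is at most the decrease of \<open>H\<close> over the step of
  length \<open>c\<close> that ends there, and the total decrease is at most \<open>H a - m\<close>.
\<close>

lemma summable_shifts_of_antimono:
  fixes g H :: "real \<Rightarrow> real"
  assumes d: "\<And>x. x > 0 \<Longrightarrow> (H has_field_derivative - g x) (at x)"
    and anti: "\<And>x y. 0 < x \<Longrightarrow> x \<le> y \<Longrightarrow> g y \<le> g x"
    and nn: "\<And>x. 0 < x \<Longrightarrow> 0 \<le> g x"
    and bd: "\<And>x. 0 < x \<Longrightarrow> m \<le> H x"
    and a: "a > 0" and c: "c > 0"
  shows "summable (\<lambda>k. g (a + real k * c))"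
proof -
  let ?t = "\<lambda>k. a + real k * c"
  have pos: "?t k > 0" for k
    using a c by (simp add: add_pos_nonneg)
  have step: "c * g (?t (Suc k)) \<le> H (?t k) - H (?t (Suc k))" for k
  proof -
    have "\<exists>z>?t k. z < ?t (Suc k) \<and> H (?t (Suc k)) - H (?t k) = (?t (Suc k) - ?t k) * - g z"
      using pos[of k] c by (intro MVT2 d) (auto simp: algebra_simps)
    then obtain z where z: "?t k < z" "z < ?t (Suc k)"
      and eq: "H (?t (Suc k)) - H (?t k) = (?t (Suc k) - ?t k) * - g z"
      by blast
    have "g (?t (Suc k)) \<le> g z"
      using z pos[of k] by (intro anti) auto
    then have "c * g (?t (Suc k)) \<le> c * g z"
      using c by simp
    with eq show ?thesis by (simp add: algebra_simps)
  qed
  have "(\<Sum>k<n. c * g (?t (Suc k))) \<le> H a - m" for n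
  proof -
    have "(\<Sum>k<n. c * g (?t (Suc k))) \<le> (\<Sum>k<n. H (?t k) - H (?t (Suc k)))"
      by (intro sum_mono step)
    also have "\<dots> = H (?t 0) - H (?t n)"
      by (rule sum_lessThan_telescope')
    also have "\<dots> \<le> H a - m"
      using bd[OF pos[of n]] by simp
    finally show ?thesis .
  qed
  moreover have "0 \<le> c * g (?t (Suc k))" for k
    using nn[OF pos[of "Suc k"]] c by simp
  ultimately have "summable (\<lambda>k. c * g (?t (Suc k)))"
    by (intro summableI_nonneg_bounded)
  then have "summable (\<lambda>k. g (?t (Suc k)))"
    using c by simp
  then show ?thesis
    by (subst (asm) summable_Suc_iff)
qed

text \<open>
  The integral test applies with \<open>- B\<close> as \<open>H\<close> for \<open>n = 0\<close>, where boundedness of \<open>B\<close> enters, and with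
  the preceding alternating derivative, bounded below by \<open>0\<close>, for \<open>n > 0\<close>.
\<close>

lemma BFb0_summable_alt_deriv:
  assumes B: "B \<in> BFb0" and a: "a > 0" and c: "c > 0"
  shows "summable (\<lambda>k. alt_deriv B n (a + real k * c))"
proof -
  have BF: "B \<in> BF" using B by (simp add: BFb0_def)
  note anti = BF_alt_deriv_antimono[OF BF] and nn = BF_alt_deriv_nonneg[OF BF]
  show ?thesis
  proof (cases n)
    case 0
    obtain K where K: "norm (B x) \<le> K" if "x \<ge> 0" for x
      using B unfolding BFb0_def bounded_iff by auto
    have "- K \<le> - B x" if "x > 0" for x
      using K[of x] that by simp
    moreover have "((\<lambda>x. - B x) has_field_derivative - alt_deriv B 0 x) (at x)" if "x > 0" for x
      by (intro DERIV_minus BF_has_deriv BF that)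
    ultimately show ?thesis
      unfolding 0 by (intro summable_shifts_of_antimono[where H = "\<lambda>x. - B x"] anti nn a c)
  next
    case (Suc m)
    show ?thesis
      unfolding Suc
      by (rule summable_shifts_of_antimono[where H = "alt_deriv B m" and m = 0,
            OF BF_alt_deriv_has_deriv[OF BF] anti nn nn a c])
  qed
qed

text \<open>
  On \<open>[x/2,\<infinity>)\<close> the differentiated series is dominated by its values at \<open>x/2\<close>. The factor \<open>s\<close> is a
  sign: it is \<open>1\<close> for the series of increments of a Bernstein function, whose derivative is
  \<open>alt_deriv B 0\<close>, and \<open>-1\<close> for the series of its alternating derivatives.
\<close>

lemma shifted_series_has_deriv:
  fixes f :: "nat \<Rightarrow> real \<Rightarrow> real"
  assumes d: "\<And>k x. x > 0 \<Longrightarrow> (f k has_field_derivative s * g (x + real k * c)) (at x)"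
    and anti: "\<And>x y. 0 < x \<Longrightarrow> x \<le> y \<Longrightarrow> g y \<le> g x"
    and nn: "\<And>x. 0 < x \<Longrightarrow> 0 \<le> g x"
    and sum_g: "\<And>a. a > 0 \<Longrightarrow> summable (\<lambda>k. g (a + real k * c))"
    and sum_f: "\<And>a. a > 0 \<Longrightarrow> summable (\<lambda>k. f k a)"
    and c: "c > 0" and x: "x > 0"
  shows "((\<lambda>x. \<Sum>k. f k x) has_field_derivative s * (\<Sum>k. g (x + real k * c))) (at x)"
proof -
  have pos: "a + real k * c > 0" if "a > 0" for a k
    using that c by (simp add: add_pos_nonneg)
  have "((\<lambda>x. \<Sum>k. f k x) has_field_derivative (\<Sum>k. s * g (x + real k * c))) (at x)"
  proof (rule has_field_derivative_series'(2)[where S = "{x/2..}" and ?x0.0 = x])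
    show "(f k has_real_derivative s * g (y + real k * c)) (at y within {x/2..})"
      if "y \<in> {x/2..}" for k y
      using d[of y k] that x by (auto intro: has_field_derivative_at_within)
    show "uniformly_convergent_on {x/2..} (\<lambda>n y. \<Sum>k<n. s * g (y + real k * c))"
    proof (rule Weierstrass_m_test')
      show "norm (s * g (y + real k * c)) \<le> \<bar>s\<bar> * g (x/2 + real k * c)"
        if "y \<in> {x/2..}" for k y
        using nn[OF pos[of y k]] anti[OF pos[of "x/2" k], of "y + real k * c"] that x
        by (auto simp: abs_mult intro!: mult_left_mono)
      show "summable (\<lambda>k. \<bar>s\<bar> * g (x/2 + real k * c))"
        using x by (intro summable_mult sum_g) simp
    qed
    show "summable (\<lambda>k. f k x)" by (rule sum_f[OF x])
    show "x \<in> interior {x/2..}" using x by (simp add: interior_real_atLeast)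
  qed (use x in auto)
  then show ?thesis
    using sum_g[OF x] by (simp add: suminf_mult)
qed

lemma theta_telescope:
  "theta (real n * c) f x = (\<Sum>k<n. theta c f (x + real k * c) - theta c f (real k * c))"
proof -
  have "(\<Sum>k<n. theta c f (x + real k * c) - theta c f (real k * c))
      = (\<Sum>k<n. (f (x + real k * c) - f (real k * c)) - (f (x + real (Suc k) * c) - f (real (Suc k) * c)))"
    by (intro sum.cong) (simp_all add: theta_def algebra_simps)
  also have "\<dots> = theta (real n * c) f x"
    by (subst sum_lessThan_telescope') (simp add: theta_def)
  finally show ?thesis by simp
qed

text \<open>
  With \<open>B = theta c f\<close>, telescoping and the increments at infinity give
  \<open>f x = f 0 + x * L + (\<Sum>k. B (x + k * c) - B (k * c))\<close>. Every term of the series is a Bernstein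
  function, and the series may be differentiated term by term any number of times. Continuity at
  \<open>0\<close> needs a separate argument: once \<open>f\<close> is known to be continuous at \<open>c\<close>, it follows from that of
  \<open>B\<close>.
\<close>

lemma BF_if_theta_and_increments:
  fixes f :: "real \<Rightarrow> real"
  assumes nn: "\<And>x. x \<ge> 0 \<Longrightarrow> f x \<ge> 0"
    and c: "c > 0" and B: "theta c f \<in> BFb0"
    and lim: "\<And>h. h \<ge> 0 \<Longrightarrow> \<exists>l. ((\<lambda>x. f (x + h) - f x) \<longlongrightarrow> l) at_top"
  shows "f \<in> BF"
proof -
  define B where "B = theta c f"
  have BFb0: "B \<in> BFb0" and BF: "B \<in> BF" and B0: "B 0 = 0"
    using B by (simp_all add: B_def BFb0_def)
  obtain L where L: "L \<ge> 0" "\<And>h. h \<ge> 0 \<Longrightarrow> ((\<lambda>x. f (x + h) - f x) \<longlongrightarrow> h * L) at_top"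
    using nonneg_increment_limit_linear[OF nn lim] by blast
  have pos: "x + real k * c > 0" if "x > 0" for x k
    using that c by (simp add: add_pos_nonneg)
  note summable = BFb0_summable_alt_deriv[OF BFb0 _ c]
  note anti = BF_alt_deriv_antimono[OF BF] and nonneg = BF_alt_deriv_nonneg[OF BF]
  have sums: "(\<lambda>k. B (x + real k * c) - B (real k * c)) sums (f x - f 0 - x * L)" if "x > 0" for x
  proof -
    have "(\<lambda>n. f (real n * c + x) - f (real n * c)) \<longlonglongrightarrow> x * L"
      using filterlim_compose[OF L(2) filterlim_real_mult_at_top[OF c], of x] that by simp
    then have "(\<lambda>n. f x - f 0 - (f (real n * c + x) - f (real n * c))) \<longlonglongrightarrow> f x - f 0 - x * L"
      by (intro tendsto_intros)
    moreover have "theta (real n * c) f x = f x - f 0 - (f (real n * c + x) - f (real n * c))" for n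
      by (simp add: theta_def add.commute)
    ultimately have "(\<lambda>n. theta (real n * c) f x) \<longlonglongrightarrow> f x - f 0 - x * L"
      by simp
    then show ?thesis
      unfolding sums_def theta_telescope B_def .
  qed
  have f_eq: "f x = f 0 + x * L + (\<Sum>k. B (x + real k * c) - B (real k * c))" if "x > 0" for x
    using sums_unique[OF sums[OF that]] by simp
  define g where "g n x = (if n = 0 then L else 0) + (\<Sum>k. alt_deriv B n (x + real k * c))" for n x
  have d0: "(f has_field_derivative g 0 x) (at x)" if "x > 0" for x
  proof -
    have "((\<lambda>x. \<Sum>k. B (x + real k * c) - B (real k * c)) has_field_derivative
        1 * (\<Sum>k. alt_deriv B 0 (x + real k * c))) (at x)"
    proof (rule shifted_series_has_deriv[OF _ anti nonneg summable _ c that])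
      show "((\<lambda>x. B (x + real k * c) - B (real k * c)) has_field_derivative
          1 * alt_deriv B 0 (y + real k * c)) (at y)" if "y > 0" for k y
        using BF_has_deriv[OF BF pos[OF that, of k]] that
        by (auto intro!: derivative_eq_intros simp: DERIV_shift)
    qed (use sums_summable[OF sums] in auto)
    then have d: "((\<lambda>x. f 0 + x * L + (\<Sum>k. B (x + real k * c) - B (real k * c))) has_field_derivative g 0 x) (at x)"
      by (auto intro!: derivative_eq_intros simp: g_def)
    have "\<forall>\<^sub>F y in nhds x. f y = f 0 + y * L + (\<Sum>k. B (y + real k * c) - B (real k * c))"
      using eventually_nhds_in_open[of "{0<..}" x] that
      by (auto elim!: eventually_mono intro: f_eq)
    from DERIV_cong_ev[OF refl this refl] d show ?thesis
      by blast
  qed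
  have dS: "(g n has_field_derivative - g (Suc n) x) (at x)" if "x > 0" for n x
  proof -
    have "((\<lambda>x. \<Sum>k. alt_deriv B n (x + real k * c)) has_field_derivative
        -1 * (\<Sum>k. alt_deriv B (Suc n) (x + real k * c))) (at x)"
    proof (rule shifted_series_has_deriv[OF _ anti nonneg summable summable c that])
      show "((\<lambda>x. alt_deriv B n (x + real k * c)) has_field_derivative
          -1 * alt_deriv B (Suc n) (y + real k * c)) (at y)" if "y > 0" for k y
        using BF_alt_deriv_has_deriv[OF BF pos[OF that, of k], of n] by (simp add: DERIV_shift)
    qed
    then show ?thesis
      unfolding g_def[abs_def] by (auto intro!: derivative_eq_intros)
  qed
  show ?thesis
  proof (rule BF_I[OF d0 dS])
    show "g n x \<ge> 0" if "x > 0" for n x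
      unfolding g_def using L(1) that by (auto intro!: add_nonneg_nonneg suminf_nonneg summable nonneg pos)
    have "isCont f (0 + c)"
      using d0[OF c] by (auto intro: DERIV_isCont)
    then have "((\<lambda>x. f (x + c)) \<longlongrightarrow> f (0 + c)) (at_right 0)"
      by (intro isCont_tendsto_compose[of _ f] tendsto_intros)
    then have "((\<lambda>x. B x - f c + f 0 + f (x + c)) \<longlongrightarrow> B 0 - f c + f 0 + f (0 + c)) (at_right 0)"
      by (intro tendsto_add tendsto_diff tendsto_const BF_tendsto_at_right[OF BF])
    then show "(f \<longlongrightarrow> f 0) (at_right 0)"
      using B0 by (simp add: B_def theta_def)
  qed (auto intro: nn)
qed

lemma increments_if_theta_in_BFb0:
  assumes "h > 0 \<Longrightarrow> theta h f \<in> BFb0" "h \<ge> 0"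
  shows "\<exists>l. ((\<lambda>x. f (x + h) - f x) \<longlongrightarrow> l) at_top"
proof (cases "h = 0")
  case False
  then obtain l where "(theta h f \<longlongrightarrow> l) at_top"
    using assms BFb0_tendsto[of "theta h f"] by force
  then have "((\<lambda>x. f h - f 0 - theta h f x) \<longlongrightarrow> f h - f 0 - l) at_top"
    by (intro tendsto_intros)
  then show ?thesis by (auto simp: theta_def)
qed auto


section \<open>The characterisation and the representation\<close>

theorem proposition3:
  fixes \<Phi> :: "real \<Rightarrow> real"
  assumes nonneg: "\<forall>x\<ge>0. \<Phi> x \<ge> 0"
    and meas: "\<Phi> \<in> borel_measurable (restrict_space borel {0..})"
  shows
    "(\<Phi> \<in> BF \<longleftrightarrow> (\<forall>c>0. theta c \<Phi> \<in> BFb0)) \<and>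
     (\<Phi> \<in> BF \<longleftrightarrow>
        (\<exists>c>0. theta c \<Phi> \<in> BFb0) \<and>
        (\<forall>h\<ge>0. \<exists>l. ((\<lambda>x. \<Phi> (x + h) - \<Phi> x) \<longlongrightarrow> l) at_top)) \<and>
     (\<Phi> \<in> BF \<longrightarrow>
        (\<exists>L \<Psi>. ((\<lambda>x. \<Phi> x / x) \<longlongrightarrow> L) at_top \<and>
           \<Psi> \<in> BF \<and> \<Psi> 0 = 0 \<and>
           (\<forall>x\<ge>0. \<Phi> x = \<Phi> 0 + x * L + \<Psi> x) \<and>
           (\<forall>c>0.
              (\<forall>x\<ge>0. (\<lambda>n. theta (real n * c) \<Phi> x) \<longlonglongrightarrow> \<Psi> x) \<and>
              locally_uniform_limit {0..} (\<lambda>n. theta (real n * c) \<Phi>) \<Psi> \<and>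
              (\<forall>k\<ge>1.
                 (\<forall>x>0. (\<lambda>n. (deriv ^^ k) (theta (real n * c) \<Phi>) x) \<longlonglongrightarrow> (deriv ^^ k) \<Psi> x) \<and>
                 locally_uniform_limit {0<..}
                   (\<lambda>n. (deriv ^^ k) (theta (real n * c) \<Phi>)) ((deriv ^^ k) \<Psi>)))))"
proof (intro conjI)
  let ?inc = "\<forall>h\<ge>0. \<exists>l. ((\<lambda>x. \<Phi> (x + h) - \<Phi> x) \<longlongrightarrow> l) at_top"
  have all: "\<forall>c>0. theta c \<Phi> \<in> BFb0" if "\<Phi> \<in> BF"
    using that by (auto intro: theta_of_BF(1))
  have inc: ?inc if "\<forall>c>0. theta c \<Phi> \<in> BFb0"
    using that by (auto intro: increments_if_theta_in_BFb0)
  have BF: "\<Phi> \<in> BF" if "c > 0" "theta c \<Phi> \<in> BFb0" ?inc for c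
    using nonneg that by (intro BF_if_theta_and_increments[of \<Phi> c]) auto
  show "\<Phi> \<in> BF \<longleftrightarrow> (\<forall>c>0. theta c \<Phi> \<in> BFb0)"
  proof
    assume t: "\<forall>c>0. theta c \<Phi> \<in> BFb0"
    show "\<Phi> \<in> BF"
      by (rule BF[OF zero_less_one]) (use t inc[OF t] in simp_all)
  qed (rule all)
  show "\<Phi> \<in> BF \<longleftrightarrow> (\<exists>c>0. theta c \<Phi> \<in> BFb0) \<and> ?inc"
  proof
    assume "\<Phi> \<in> BF"
    from all[OF this] show "(\<exists>c>0. theta c \<Phi> \<in> BFb0) \<and> ?inc"
      using inc by (intro conjI exI[of _ 1]) simp_all
  qed (use BF in blast)
next
  show "\<Phi> \<in> BF \<longrightarrow>
        (\<exists>L \<Psi>. ((\<lambda>x. \<Phi> x / x) \<longlongrightarrow> L) at_top \<and>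
           \<Psi> \<in> BF \<and> \<Psi> 0 = 0 \<and>
           (\<forall>x\<ge>0. \<Phi> x = \<Phi> 0 + x * L + \<Psi> x) \<and>
           (\<forall>c>0.
              (\<forall>x\<ge>0. (\<lambda>n. theta (real n * c) \<Phi> x) \<longlonglongrightarrow> \<Psi> x) \<and>
              locally_uniform_limit {0..} (\<lambda>n. theta (real n * c) \<Phi>) \<Psi> \<and>
              (\<forall>k\<ge>1.
                 (\<forall>x>0. (\<lambda>n. (deriv ^^ k) (theta (real n * c) \<Phi>) x) \<longlonglongrightarrow> (deriv ^^ k) \<Psi> x) \<and>
                 locally_uniform_limit {0<..}
                   (\<lambda>n. (deriv ^^ k) (theta (real n * c) \<Phi>)) ((deriv ^^ k) \<Psi>))))"
  proof
    assume f: "\<Phi> \<in> BF"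
    obtain L where L: "(alt_deriv \<Phi> 0 \<longlongrightarrow> L) at_top" "\<And>x. x > 0 \<Longrightarrow> L \<le> alt_deriv \<Phi> 0 x"
      using BF_alt_deriv_tendsto[OF f] by blast
    define \<Psi> where "\<Psi> = (\<lambda>x. \<Phi> x - \<Phi> 0 - x * L)"
    have uniform: "uniform_limit {0..b} (\<lambda>n. theta (real n * c) \<Phi>) \<Psi> sequentially"
      "uniform_limit {0<..} (\<lambda>n. (deriv ^^ Suc k) (theta (real n * c) \<Phi>)) ((deriv ^^ Suc k) \<Psi>) sequentially"
      if "c > 0" for b c k
      unfolding \<Psi>_def by (intro BF_theta_convergence f L that; assumption)+
    show "\<exists>L \<Psi>. ((\<lambda>x. \<Phi> x / x) \<longlongrightarrow> L) at_top \<and>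
           \<Psi> \<in> BF \<and> \<Psi> 0 = 0 \<and>
           (\<forall>x\<ge>0. \<Phi> x = \<Phi> 0 + x * L + \<Psi> x) \<and>
           (\<forall>c>0.
              (\<forall>x\<ge>0. (\<lambda>n. theta (real n * c) \<Phi> x) \<longlonglongrightarrow> \<Psi> x) \<and>
              locally_uniform_limit {0..} (\<lambda>n. theta (real n * c) \<Phi>) \<Psi> \<and>
              (\<forall>k\<ge>1.
                 (\<forall>x>0. (\<lambda>n. (deriv ^^ k) (theta (real n * c) \<Phi>) x) \<longlonglongrightarrow> (deriv ^^ k) \<Psi> x) \<and>
                 locally_uniform_limit {0<..}
                   (\<lambda>n. (deriv ^^ k) (theta (real n * c) \<Phi>)) ((deriv ^^ k) \<Psi>)))"
    proof (intro exI[of _ L] exI[of _ \<Psi>] conjI allI impI)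
      show "((\<lambda>x. \<Phi> x / x) \<longlongrightarrow> L) at_top"
        by (rule BF_divide_tendsto[OF f L(1)])
      show "\<Psi> \<in> BF"
        unfolding \<Psi>_def by (rule BF_remove_linear_part(1)[OF f L(2)])
      show "\<Psi> 0 = 0" "\<And>x. \<Phi> x = \<Phi> 0 + x * L + \<Psi> x"
        by (simp_all add: \<Psi>_def)
    next
      fix c :: real assume c: "c > 0"
      show "(\<lambda>n. theta (real n * c) \<Phi> x) \<longlonglongrightarrow> \<Psi> x" if "x \<ge> 0" for x
        by (rule tendsto_uniform_limitI[OF uniform(1)[OF c, of x]]) (simp add: that)
      show "locally_uniform_limit {0..} (\<lambda>n. theta (real n * c) \<Phi>) \<Psi>"
        unfolding locally_uniform_limit_def
      proof
        fix x :: real assume x: "x \<in> {0..}"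
        have "uniform_limit ({0..} \<inter> {..<x + 1}) (\<lambda>n. theta (real n * c) \<Phi>) \<Psi> sequentially"
          by (rule uniform_limit_on_subset[OF uniform(1)[OF c, of "x + 1"]]) auto
        moreover have "openin (top_of_set {0..}) ({0..} \<inter> {..<x + 1})"
          by (intro openin_open_Int) simp
        ultimately show "\<exists>U. openin (top_of_set {0..}) U \<and> x \<in> U \<and>
            uniform_limit U (\<lambda>n. theta (real n * c) \<Phi>) \<Psi> sequentially"
          using x by (intro exI[of _ "{0..} \<inter> {..<x + 1}"]) auto
      qed
      fix k :: nat assume "k \<ge> 1"
      then obtain m where k: "k = Suc m" by (cases k) auto
      note U = uniform(2)[OF c, of m, folded k]
      show "(\<lambda>n. (deriv ^^ k) (theta (real n * c) \<Phi>) x) \<longlonglongrightarrow> (deriv ^^ k) \<Psi> x" if "x > 0" for x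
        by (rule tendsto_uniform_limitI[OF U]) (simp add: that)
      show "locally_uniform_limit {0<..} (\<lambda>n. (deriv ^^ k) (theta (real n * c) \<Phi>)) ((deriv ^^ k) \<Psi>)"
        unfolding locally_uniform_limit_def using U by (intro ballI exI[of _ "{0<..}"]) auto
    qed
  qed
qed

end
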